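(* Let $C\subseteq\mathbb{R}^n$ be nonempty and closed (possibly nonconvex) and let $D_1,\dots,D_m\subseteq\mathbb{R}^n$ be nonempty, closed and convex, with $C^\infty\cap\bigcap_{i=1}^mD_i^\infty=\{0\}$. Let $\psi\in\Theta$ and $\Psi(x):=\sum_{i=1}^m\psi(d_{D_i}^2(x))$, and suppose that $\Psi+\delta_C$ is a KL function. Let $\{x^t\}$ be the sequence generated by the algorithm sGP$_{ls}$ with $M=0$ applied to $\min_{x\in C}\Psi(x)$. Then $\{x^t\}$ converges to a stationary point of $\Psi+\delta_C$.
   Context: $\Theta$ denotes the set of level-bounded (i.e., $\{s\ge0:\psi(s)\le\gamma\}$ is bounded for every $\gamma\in\mathbb{R}$) continuous concave functions $\psi:\mathbb{R}_+\to\mathbb{R}_+$ such that: (1) $\psi$ is continuously differentiable on $(0,\infty)$ with positive derivative and $\psi(0)=0$; (2) $\lim_{s\downarrow0}\psi'(s)$ exists (as a real number) and is positive, and the right derivative $\psi'_+$ is Lipschitz continuous on $\mathbb{R}_+=[0,\infty)$. For a nonempty closed set $D\subseteq\mathbb{R}^n$: $d_D(x)=\inf_{y\in D}\|x-y\|$ (also written $\mathrm{dist}(x,D)$); $P_D(x)=\{y\in D:\|x-y\|=d_D(x)\}$ is the set of projections; $D^\infty:=\{x:\exists\, x^t\in D,\ \lambda_t\downarrow0\text{ with }\lambda_tx^t\to x\}$ is the horizon cone; $\delta_D$ is the indicator function ($0$ on $D$, $+\infty$ elsewhere). For a proper closed $f$ and $\bar x\in\mathrm{dom} f$, $\widehat\partial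 f(\bar x)=\{v:\liminf_{x\to\bar x,x\ne\bar x}\frac{f(x)-f(\bar x)-\langle v,x-\bar x\rangle}{\|x-\bar x\|}\ge0\}$ and $\partial f(\bar x)=\{v:\exists\,x^t\to\bar x,\ f(x^t)\to f(\bar x),\ v^t\in\widehat\partial f(x^t),\ v^t\to v\}$ (empty outside $\mathrm{dom} f$); $\mathrm{dom}\,\partial f=\{x:\partial f(x)\ne\emptyset\}$. $N_C(x)=\partial\delta_C(x)$ for $x\in C$. A point $\bar x\in C$ is a stationary point of $\Psi+\delta_C$ if $0\in\sum_{i=1}^m[2\psi_+'(d_{D_i}^2(\bar x))(\bar x-P_{D_i}(\bar x))]+N_C(\bar x)$. For $\nu\in(0,\infty]$, $\Xi_\nu$ is the set of continuous concave functions $\phi:[0,\nu)\to\mathbb{R}_+$ that are continuously differentiable on $(0,\nu)$ with positive derivatives and satisfy $\phi(0)=0$. A proper closed function $f$ satisfies the KL property at $\hat x\in\mathrm{dom}\,\partial f$ if there exist a neighborhood $\mathcal N$ of $\hat x$, $\nu\in(0,\infty]$ and $\phi\in\Xi_\nu$ such that $\phi'(f(x)-f(\hat x))\,\mathrm{dist}(0,\partial f(x))\ge1$ whenever $x\in\mathcal N$ and $f(\hat x)<f(x)<f(\hat x)+\nu$. $f$ is a KL function if it satisfies the KL property at every point of $\mathrm{dom}\,\partial f$. Algorithm sGP$_{ls}$: Choose $\alpha_{\max}>\alpha_{\min}>0$, $\eta\in(0,1)$, $\sigma>0$, an integer $M\ge0$ and $x^0\in C$. For $t=0,1,2,\dots$: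 choose any $\alpha_t^0\in[\alpha_{\min},\alpha_{\max}]$, set $\alpha=\alpha_t^0$, pick any $\xi_i^t\in P_{D_i}(x^t)$ for $i=1,\dots,m$, and set $g^t:=2\sum_{i=1}^m\psi_+'(d_{D_i}^2(x^t))(x^t-\xi_i^t)$. Inner loop: choose any $\tilde u\in\operatorname{arg\,min}_{u\in C}\{\langle g^t,u-x^t\rangle+\frac1{2\alpha}\|u-x^t\|^2\}$; if $\Psi(\tilde u)-\max_{\max\{t-M,0\}\le i\le t}\Psi(x^i)\le-\frac\sigma2\|\tilde u-x^t\|^2$, set $\alpha_t:=\alpha$, $x^{t+1}:=\tilde u$ and pass to the next $t$; otherwise replace $\alpha$ by $\eta\alpha$ and repeat the inner loop. *)

theory Defs
  imports "HOL-Analysis.Analysis" "HOL-Library.Set_Algebras"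
begin

section \<open>Variational analysis\<close>

definition proj :: "'a::metric_space set \<Rightarrow> 'a \<Rightarrow> 'a set" where
  "proj D x = {y \<in> D. dist x y = infdist x D}"

text \<open>\<open>\<lambda>\<^sub>t \<down> 0\<close> means \<open>\<lambda>\<^sub>t > 0\<close> and \<open>\<lambda>\<^sub>t \<rightarrow> 0\<close>.\<close>

definition horizon_cone :: "'a::real_normed_vector set \<Rightarrow> 'a set" where
  "horizon_cone D =
    {x. \<exists>X lam. (\<forall>t::nat. X t \<in> D \<and> lam t > (0::real)) \<and> lam \<longlonglongrightarrow> 0
         \<and> (\<lambda>t. lam t *\<^sub>R X t) \<longlonglongrightarrow> x}"

definition indicator_ereal :: "'a set \<Rightarrow> 'a \<Rightarrow> ereal" where
  "indicator_ereal D x = (if x \<in> D then 0 else \<infinity>)"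

definition edom :: "('a \<Rightarrow> ereal) \<Rightarrow> 'a set" where
  "edom f = {x. f x < \<infinity>}"

definition proper :: "('a \<Rightarrow> ereal) \<Rightarrow> bool" where
  "proper f \<longleftrightarrow> (\<forall>x. f x \<noteq> -\<infinity>) \<and> edom f \<noteq> {}"

text \<open>A function is closed if it is lower semicontinuous.\<close>

definition closed_fun :: "('a::topological_space \<Rightarrow> ereal) \<Rightarrow> bool" where
  "closed_fun f \<longleftrightarrow> (\<forall>x. f x \<le> Liminf (at x) f)"

definition regular_subdiff :: "('a::real_inner \<Rightarrow> ereal) \<Rightarrow> 'a \<Rightarrow> 'a set" where
  "regular_subdiff f xb =
    {v. xb \<in> edom f \<and>
        0 \<le> Liminf (at xb) (\<lambda>x. (f x - f xb - ereal (v \<bullet> (x - xb))) / ereal (norm (x - xb)))}"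

definition subdiff :: "('a::real_inner \<Rightarrow> ereal) \<Rightarrow> 'a \<Rightarrow> 'a set" where
  "subdiff f xb =
    {v. xb \<in> edom f \<and>
        (\<exists>X V. X \<longlonglongrightarrow> xb \<and> (\<lambda>t. f (X t)) \<longlonglongrightarrow> f xb
             \<and> (\<forall>t::nat. V t \<in> regular_subdiff f (X t)) \<and> V \<longlonglongrightarrow> v)}"

definition normal_cone :: "'a::real_inner set \<Rightarrow> 'a \<Rightarrow> 'a set" where
  "normal_cone C x = subdiff (indicator_ereal C) x"

section \<open>The Kurdyka-Lojasiewicz property\<close>

definition KL_desingularizer :: "ereal \<Rightarrow> (real \<Rightarrow> real) \<Rightarrow> bool" where
  "KL_desingularizer \<nu> \<phi> \<longleftrightarrow>
     (\<forall>s\<in>{s. 0 \<le> s \<and> ereal s < \<nu>}. 0 \<le> \<phi> s) \<and>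
     continuous_on {s. 0 \<le> s \<and> ereal s < \<nu>} \<phi> \<and>
     concave_on {s. 0 \<le> s \<and> ereal s < \<nu>} \<phi> \<and>
     (\<forall>s\<in>{s. 0 < s \<and> ereal s < \<nu>}. \<phi> differentiable (at s) \<and> 0 < deriv \<phi> s) \<and>
     continuous_on {s. 0 < s \<and> ereal s < \<nu>} (deriv \<phi>) \<and>
     \<phi> 0 = 0"

text \<open>
  The distance \<open>dist(0, \<partial>f(x))\<close> is taken in \<open>ereal\<close>, so that it is \<open>\<infinity>\<close> when \<open>\<partial>f(x)\<close> is
  empty; \<^const>\<open>infdist\<close> would give \<open>0\<close>.
\<close>

definition KL_property_at :: "('a::real_inner \<Rightarrow> ereal) \<Rightarrow> 'a \<Rightarrow> bool" where
  "KL_property_at f xh \<longleftrightarrow>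
     (\<exists>U \<nu> \<phi>. open U \<and> xh \<in> U \<and> 0 < \<nu> \<and> KL_desingularizer \<nu> \<phi> \<and>
       (\<forall>x\<in>U. f xh < f x \<and> f x < f xh + \<nu> \<longrightarrow>
          1 \<le> ereal (deriv \<phi> (real_of_ereal (f x - f xh))) * (INF v\<in>subdiff f x. ereal (norm v))))"

definition KL_function :: "('a::real_inner \<Rightarrow> ereal) \<Rightarrow> bool" where
  "KL_function f \<longleftrightarrow> proper f \<and> closed_fun f \<and> (\<forall>xh. subdiff f xh \<noteq> {} \<longrightarrow> KL_property_at f xh)"

section \<open>The objective\<close>

definition right_deriv :: "(real \<Rightarrow> real) \<Rightarrow> real \<Rightarrow> real" where
  "right_deriv \<psi> s = Lim (at_right s) (\<lambda>u. (\<psi> u - \<psi> s) / (u - s))"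

text \<open>Functions on \<open>\<real>\<^sub>+\<close> are total functions whose values on the negative axis are irrelevant.\<close>

definition Theta :: "(real \<Rightarrow> real) set" where
  "Theta = {\<psi>.
     (\<forall>s\<ge>0. 0 \<le> \<psi> s) \<and>
     (\<forall>\<gamma>. bounded {s. 0 \<le> s \<and> \<psi> s \<le> \<gamma>}) \<and>
     continuous_on {0..} \<psi> \<and>
     concave_on {0..} \<psi> \<and>
     (\<forall>s>0. \<psi> differentiable (at s) \<and> 0 < deriv \<psi> s) \<and>
     continuous_on {0<..} (deriv \<psi>) \<and>
     \<psi> 0 = 0 \<and>
     (\<exists>l>0. (deriv \<psi> \<longlongrightarrow> l) (at_right 0)) \<and>
     (\<exists>L. L-lipschitz_on {0..} (right_deriv \<psi>))}"

definition Psi :: "(nat \<Rightarrow> 'a::metric_space set) \<Rightarrow> nat \<Rightarrow> (real \<Rightarrow> real) \<Rightarrow> 'a \<Rightarrow> real" where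
  "Psi D m \<psi> x = (\<Sum>i=1..m. \<psi> ((infdist x (D i))\<^sup>2))"

text \<open>The sums of sets below are Minkowski sums.\<close>

definition stationary_point ::
  "'a::real_inner set \<Rightarrow> (nat \<Rightarrow> 'a set) \<Rightarrow> nat \<Rightarrow> (real \<Rightarrow> real) \<Rightarrow> 'a \<Rightarrow> bool" where
  "stationary_point C D m \<psi> x \<longleftrightarrow> x \<in> C \<and>
     0 \<in> (\<Sum>i=1..m. (\<lambda>y. (2 * right_deriv \<psi> ((infdist x (D i))\<^sup>2)) *\<^sub>R (x - y)) ` proj (D i) x)
          + normal_cone C x"

section \<open>The algorithm\<close>

definition trial_points :: "'a::real_inner set \<Rightarrow> 'a \<Rightarrow> 'a \<Rightarrow> real \<Rightarrow> 'a set" where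
  "trial_points C x g \<alpha> =
    {u. is_arg_min (\<lambda>u. g \<bullet> (u - x) + 1 / (2 * \<alpha>) * (norm (u - x))\<^sup>2) (\<lambda>u. u \<in> C) u}"

text \<open>
  \<open>line_search C F \<eta> \<sigma> R x g \<alpha> u\<close>: the inner loop, entered with step size \<open>\<alpha>\<close>, can terminate
  with output \<open>u\<close>, where \<open>F\<close> is the objective and \<open>R\<close> the reference value. Each rejected pass may
  use an arbitrary minimizer.
\<close>

inductive line_search ::
  "'a::real_inner set \<Rightarrow> ('a \<Rightarrow> real) \<Rightarrow> real \<Rightarrow> real \<Rightarrow> real \<Rightarrow> 'a \<Rightarrow> 'a \<Rightarrow> real \<Rightarrow> 'a \<Rightarrow> bool"
  for C F \<eta> \<sigma> R x g where
  accept: "u \<in> trial_points C x g \<alpha> \<Longrightarrow> F u - R \<le> - (\<sigma> / 2) * (norm (u - x))\<^sup>2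
    \<Longrightarrow> line_search C F \<eta> \<sigma> R x g \<alpha> u"
| backtrack: "v \<in> trial_points C x g \<alpha> \<Longrightarrow> \<not> F v - R \<le> - (\<sigma> / 2) * (norm (v - x))\<^sup>2
    \<Longrightarrow> line_search C F \<eta> \<sigma> R x g (\<eta> * \<alpha>) u \<Longrightarrow> line_search C F \<eta> \<sigma> R x g \<alpha> u"

text \<open>
  The truncated subtraction \<open>t - M\<close> on \<^typ>\<open>nat\<close> is \<open>max {t - M, 0}\<close>.
\<close>

definition sGP_ls_sequence ::
  "'a::real_inner set \<Rightarrow> (nat \<Rightarrow> 'a set) \<Rightarrow> nat \<Rightarrow> (real \<Rightarrow> real) \<Rightarrow>
   real \<Rightarrow> real \<Rightarrow> real \<Rightarrow> real \<Rightarrow> nat \<Rightarrow> (nat \<Rightarrow> 'a) \<Rightarrow> bool" where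
  "sGP_ls_sequence C D m \<psi> \<alpha>min \<alpha>max \<eta> \<sigma> M x \<longleftrightarrow>
     x 0 \<in> C \<and>
     (\<forall>t. \<exists>\<alpha>\<in>{\<alpha>min..\<alpha>max}. \<exists>\<xi>. (\<forall>i\<in>{1..m}. \<xi> i \<in> proj (D i) (x t)) \<and>
        line_search C (Psi D m \<psi>) \<eta> \<sigma> (Max ((\<lambda>i. Psi D m \<psi> (x i)) ` {t - M..t})) (x t)
          (2 *\<^sub>R (\<Sum>i=1..m. right_deriv \<psi> ((infdist (x t) (D i))\<^sup>2) *\<^sub>R (x t - \<xi> i)))
          \<alpha> (x (Suc t)))"

end

theory Submission
  imports Defs
begin

text \<open>
  Since \<open>\<psi>\<close> is concave and \<open>d\<^sub>D\<^sup>2(y) \<le> \<parallel>y - P\<^sub>D(x)\<parallel>\<^sup>2\<close>, the objective has a global quadratic upper model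
  around every point, which bounds the accepted step sizes from below. Convexity of the \<open>D\<^sub>i\<close> and
  Lipschitz continuity of \<open>\<psi>'\<^sub>+\<close> give a local quadratic lower model with the same linear term, so the
  optimality condition of the subproblem turns into a proximal subgradient of \<open>\<Psi> + \<delta>\<^sub>C\<close> at \<open>x\<^sup>t\<^sup>+\<^sup>1\<close>
  whose norm is at most a multiple of \<open>\<parallel>x\<^sup>t\<^sup>+\<^sup>1 - x\<^sup>t\<parallel>\<close>. The horizon condition keeps the iterates bounded,
  and the Kurdyka-Lojasiewicz inequality at a cluster point then traps the tail of the sequence
  near that point.
\<close>

section \<open>Concave functions of one variable\<close>

lemma concave_on_below_tangent:
  fixes f :: "real \<Rightarrow> real"
  assumes "concave_on A f" "connected A" "c \<in> interior A" "y \<in> A"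
    and "(f has_real_derivative f') (at c)"
  shows "f y \<le> f c + f' * (y - c)"
proof -
  have "((\<lambda>x. - f x) has_real_derivative - f') (at c within A)"
    using assms(5) by (auto intro: derivative_eq_intros has_field_derivative_at_within)
  from convex_on_imp_above_tangent[OF _ assms(2-4) this] assms(1)
  show ?thesis by (simp add: concave_on_def)
qed

text \<open>Needed with \<open>u\<close> the next gap in function value, which may be 0. Only the
  tangency point \<open>s\<close> has to be interior, so a slope of \<open>\<phi>\<close> that blows
  up at 0 does no harm.\<close>

lemma KL_desingularizer_below_tangent:
  assumes \<phi>: "KL_desingularizer \<nu> \<phi>" and s: "0 < s" "ereal s < \<nu>" and u: "0 \<le> u" "ereal u < \<nu>"
  shows "\<phi> u \<le> \<phi> s + deriv \<phi> s * (u - s)"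
proof (rule concave_on_below_tangent)
  let ?S = "{s. 0 \<le> s \<and> ereal s < \<nu>}"
  show "concave_on ?S \<phi>" "u \<in> ?S" using \<phi> u by (auto simp: KL_desingularizer_def)
  show "connected ?S"
    by (rule connectedI_interval) (auto intro: le_less_trans[rotated])
  \<comment> \<open>Pulling back along \<open>ereal\<close> treats finite and infinite
    \<open>\<nu>\<close> alike.\<close>
  have "open ({0<..} \<inter> ereal -` {..<\<nu>})"
    by (intro open_Int open_vimage open_greaterThan open_lessThan continuous_on_ereal continuous_on_id)
  then show "s \<in> interior ?S"
    by (rule interiorI) (use s in auto)
  show "(\<phi> has_real_derivative deriv \<phi> s) (at s)"
    using \<phi> s unfolding KL_desingularizer_def DERIV_deriv_iff_real_differentiable by auto
qed

context
  fixes \<psi> :: "real \<Rightarrow> real"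
  assumes \<psi>: "\<psi> \<in> Theta"
begin

lemma Theta_has_deriv: "0 < s \<Longrightarrow> (\<psi> has_real_derivative deriv \<psi> s) (at s)"
  using \<psi> by (auto simp: Theta_def DERIV_deriv_iff_real_differentiable)

lemma Theta_below_tangent:
  assumes "0 < a" "0 \<le> b" shows "\<psi> b \<le> \<psi> a + deriv \<psi> a * (b - a)"
proof (rule concave_on_below_tangent[where A = "{0..}"])
  show "concave_on {0..} \<psi>" using \<psi> by (simp add: Theta_def)
  show "a \<in> interior {0..}" using assms by simp
qed (use assms Theta_has_deriv in \<open>auto intro: connectedI_interval\<close>)

lemma Theta_right_deriv_pos: "0 < s \<Longrightarrow> right_deriv \<psi> s = deriv \<psi> s"
  using Theta_has_deriv[of s] unfolding right_deriv_def
  by (intro tendsto_Lim)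
     (auto simp: has_field_derivative_iff intro: tendsto_mono[OF at_le[of "{s<..}" UNIV]])

text \<open>\<open>Theta\<close> speaks of the limit of \<open>deriv \<psi>\<close> at 0, whereas
  \<open>right_deriv\<close> at 0 is a limit of difference quotients. The quotient at
  \<open>u\<close> lies between \<open>deriv \<psi> u\<close> (tangent at \<open>u\<close>,
  evaluated at 0) and the limit \<open>l\<close> (tangent at \<open>a\<close>, with \<open>a\<close>
  tending to 0), so the two limits agree.\<close>

lemma Theta_right_deriv_0:
  shows "(deriv \<psi> \<longlongrightarrow> right_deriv \<psi> 0) (at_right 0)" and "0 < right_deriv \<psi> 0"
proof -
  obtain l where l: "l > 0" "(deriv \<psi> \<longlongrightarrow> l) (at_right 0)" using \<psi> by (auto simp: Theta_def)
  have 0: "\<psi> 0 = 0" and cont: "continuous_on {0..} \<psi>" using \<psi> by (auto simp: Theta_def)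
  have lim0: "(\<psi> \<longlongrightarrow> \<psi> 0) (at_right 0)"
    using cont unfolding continuous_on_def
    by (auto intro: tendsto_mono[OF at_le[of "{0<..}" "{0..}"]])
  have up: "\<psi> b \<le> l * b" if "b \<ge> 0" for b
  proof (rule tendsto_le[OF trivial_limit_at_right_real _ tendsto_const])
    show "((\<lambda>a. \<psi> a + deriv \<psi> a * (b - a)) \<longlongrightarrow> l * b) (at_right 0)"
      using tendsto_add[OF lim0 tendsto_mult[OF l(2) tendsto_diff[OF tendsto_const[of b] tendsto_ident_at]]] 0
      by simp
    show "\<forall>\<^sub>F a in at_right 0. \<psi> b \<le> \<psi> a + deriv \<psi> a * (b - a)"
      using Theta_below_tangent that by (auto simp: eventually_at_right_field intro: exI[of _ 1])
  qed
  have "((\<lambda>u. (\<psi> u - \<psi> 0) / (u - 0)) \<longlongrightarrow> l) (at_right 0)"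
  proof (rule tendsto_sandwich[OF _ _ l(2) tendsto_const])
    show "\<forall>\<^sub>F u in at_right 0. deriv \<psi> u \<le> (\<psi> u - \<psi> 0) / (u - 0)"
      using Theta_below_tangent[of _ 0] 0
      by (auto simp: eventually_at_right_field field_simps intro!: exI[of _ 1])
    show "\<forall>\<^sub>F u in at_right 0. (\<psi> u - \<psi> 0) / (u - 0) \<le> l"
      using up 0 by (auto simp: eventually_at_right_field field_simps intro!: exI[of _ 1])
  qed
  then have "right_deriv \<psi> 0 = l"
    unfolding right_deriv_def by (intro tendsto_Lim) auto
  with l show "(deriv \<psi> \<longlongrightarrow> right_deriv \<psi> 0) (at_right 0)" "0 < right_deriv \<psi> 0" by auto
qed

lemma Theta_right_deriv_nonneg: "0 \<le> s \<Longrightarrow> 0 \<le> right_deriv \<psi> s"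
  using Theta_right_deriv_0(2) Theta_right_deriv_pos[of s] \<psi>
  by (cases "s = 0") (auto simp: Theta_def intro: less_imp_le)

text \<open>At \<open>a = 0\<close> there is no two-sided tangent, so the tangent inequality at
  \<open>u > 0\<close> is passed to the limit as \<open>u\<close> tends to 0.\<close>

lemma Theta_supergradient:
  assumes "0 \<le> a" "0 \<le> b" shows "\<psi> b \<le> \<psi> a + right_deriv \<psi> a * (b - a)"
proof (cases "a = 0")
  case True
  have 0: "\<psi> 0 = 0" and cont: "continuous_on {0..} \<psi>" using \<psi> by (auto simp: Theta_def)
  have lim0: "(\<psi> \<longlongrightarrow> \<psi> 0) (at_right 0)"
    using cont unfolding continuous_on_def
    by (auto intro: tendsto_mono[OF at_le[of "{0<..}" "{0..}"]])
  show ?thesis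
  proof (rule tendsto_le[OF trivial_limit_at_right_real _ tendsto_const])
    show "((\<lambda>u. \<psi> u + deriv \<psi> u * (b - u)) \<longlongrightarrow> \<psi> a + right_deriv \<psi> a * (b - a)) (at_right 0)"
      using tendsto_add[OF lim0 tendsto_mult[OF Theta_right_deriv_0(1) tendsto_diff[OF tendsto_const[of b] tendsto_ident_at]]] True
      by simp
    show "\<forall>\<^sub>F u in at_right 0. \<psi> b \<le> \<psi> u + deriv \<psi> u * (b - u)"
      using Theta_below_tangent assms by (auto simp: eventually_at_right_field intro: exI[of _ 1])
  qed
qed (use Theta_below_tangent Theta_right_deriv_pos assms in simp)

text \<open>Adding the supergradient inequalities at \<open>a\<close> and at \<open>b\<close>
  cancels the function values.\<close>

lemma Theta_right_deriv_antimono: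
  assumes "0 \<le> a" "a \<le> b" shows "right_deriv \<psi> b \<le> right_deriv \<psi> a"
proof (cases "a = b")
  case False
  have "0 \<le> (right_deriv \<psi> a - right_deriv \<psi> b) * (b - a)"
    using Theta_supergradient[of a b] Theta_supergradient[of b a] assms by (simp add: algebra_simps)
  then show ?thesis using False assms by (simp add: zero_le_mult_iff)
qed simp

text \<open>The supergradient inequality is used with the roles swapped, at \<open>b\<close> and
  evaluated at \<open>a\<close>. Exchanging the slope at \<open>b\<close> for the slope at
  \<open>a\<close> costs at most \<open>L * (b - a)\<^sup>2\<close>.\<close>

lemma Theta_lower_quadratic:
  assumes L: "L-lipschitz_on {0..} (right_deriv \<psi>)" and "0 \<le> a" "0 \<le> b"
  shows "\<psi> a + right_deriv \<psi> a * (b - a) - L * (b - a)\<^sup>2 \<le> \<psi> b"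
proof -
  have "\<bar>right_deriv \<psi> b - right_deriv \<psi> a\<bar> \<le> L * \<bar>b - a\<bar>"
    using lipschitz_onD[OF L, of b a] assms by (simp add: dist_real_def)
  then have "\<bar>(right_deriv \<psi> b - right_deriv \<psi> a) * (b - a)\<bar> \<le> L * \<bar>b - a\<bar> * \<bar>b - a\<bar>"
    unfolding abs_mult by (intro mult_right_mono) auto
  then show ?thesis
    using Theta_supergradient[of b a] assms by (simp add: algebra_simps power2_eq_square abs_mult_self_eq)
qed

end

section \<open>Squared distances to convex sets\<close>

lemma infdist_eq_closest_point:
  fixes S :: "'a::euclidean_space set"
  assumes "closed S" "S \<noteq> {}"
  shows "infdist a S = norm (a - closest_point S a)"
proof (rule antisym)
  obtain y where y: "y \<in> S" "infdist a S = dist a y" using infdist_attains_inf[OF assms] .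
  show "norm (a - closest_point S a) \<le> infdist a S"
    unfolding y(2) dist_norm[symmetric] by (rule closest_point_le[OF assms(1) y(1)])
  show "infdist a S \<le> norm (a - closest_point S a)"
    unfolding dist_norm[symmetric] by (rule infdist_le[OF closest_point_in_set[OF assms]])
qed

lemma closest_point_in_proj:
  fixes S :: "'a::euclidean_space set"
  assumes "closed S" "S \<noteq> {}"
  shows "closest_point S a \<in> proj S a"
  using infdist_eq_closest_point[OF assms] closest_point_in_set[OF assms]
  by (simp add: proj_def dist_norm)

lemma proj_eq_closest_point:
  fixes S :: "'a::euclidean_space set"
  assumes "closed S" "convex S" "y \<in> proj S a"
  shows "y = closest_point S a"
  using assms infdist_le[of _ S a] by (intro closest_point_unique) (auto simp: proj_def)

text \<open>The projection of \<open>a\<close> is a competitor for the distance from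
  \<open>y\<close>; expanding the square around \<open>a\<close> gives the bound.\<close>

lemma sq_infdist_le:
  fixes S :: "'a::euclidean_space set"
  assumes S: "closed S" "S \<noteq> {}"
  shows "(infdist y S)\<^sup>2 \<le> (infdist a S)\<^sup>2 + 2 * ((a - closest_point S a) \<bullet> (y - a)) + (norm (y - a))\<^sup>2"
proof -
  have "infdist y S \<le> norm (y - closest_point S a)"
    using infdist_le[OF closest_point_in_set[OF S]] by (simp add: dist_norm)
  then have "(infdist y S)\<^sup>2 \<le> (norm (y - closest_point S a))\<^sup>2"
    by (simp add: infdist_nonneg)
  also have "\<dots> = (norm (a - closest_point S a))\<^sup>2 + 2 * ((a - closest_point S a) \<bullet> (y - a)) + (norm (y - a))\<^sup>2"
    unfolding power2_norm_eq_inner by (simp add: inner_diff_left inner_diff_right inner_commute)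
  finally show ?thesis by (simp add: infdist_eq_closest_point[OF S])
qed

text \<open>Gradient inequality for the convex squared distance. The gap is the squared norm of the
  difference of the two residuals minus twice an inner product that the obtuse-angle property of
  projections makes nonpositive.\<close>

lemma sq_infdist_ge:
  fixes S :: "'a::euclidean_space set"
  assumes S: "closed S" "S \<noteq> {}" "convex S"
  shows "(infdist a S)\<^sup>2 + 2 * ((a - closest_point S a) \<bullet> (y - a)) \<le> (infdist y S)\<^sup>2"
proof -
  let ?p = "closest_point S a" and ?q = "closest_point S y"
  have "(a - ?p) \<bullet> (?q - ?p) \<le> 0"
    by (rule closest_point_dot[OF S(3,1) closest_point_in_set[OF S(1,2)]])
  moreover have "(norm (y - ?q))\<^sup>2 - (norm (a - ?p))\<^sup>2 - 2 * ((a - ?p) \<bullet> (y - a))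
      = (norm ((y - ?q) - (a - ?p)))\<^sup>2 - 2 * ((a - ?p) \<bullet> (?q - ?p))"
    unfolding power2_norm_eq_inner by (simp add: inner_diff_left inner_diff_right inner_commute)
  moreover have "0 \<le> (norm ((y - ?q) - (a - ?p)))\<^sup>2" by simp
  ultimately show ?thesis unfolding infdist_eq_closest_point[OF S(1,2)] by linarith
qed

section \<open>The smooth part of the objective\<close>

text \<open>Takes the role of the gradient of \<open>\<Psi>\<close>, with the unique projection onto
  a closed convex set written as a function. The quadratic models from above and below share it as
  linear term.\<close>

definition Psi_grad :: "(nat \<Rightarrow> 'a::euclidean_space set) \<Rightarrow> nat \<Rightarrow> (real \<Rightarrow> real) \<Rightarrow> 'a \<Rightarrow> 'a" where
  "Psi_grad D m \<psi> x =
     (\<Sum>i=1..m. (2 * right_deriv \<psi> ((infdist x (D i))\<^sup>2)) *\<^sub>R (x - closest_point (D i) x))"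

locale distance_sum =
  fixes D :: "nat \<Rightarrow> 'a::euclidean_space set" and m :: nat and \<psi> :: "real \<Rightarrow> real"
  assumes D: "i \<in> {1..m} \<Longrightarrow> D i \<noteq> {} \<and> closed (D i) \<and> convex (D i)"
    and \<psi>: "\<psi> \<in> Theta"
begin

lemma Psi_nonneg: "0 \<le> Psi D m \<psi> x"
  unfolding Psi_def using \<psi> by (intro sum_nonneg) (auto simp: Theta_def)

lemma continuous_on_Psi: "continuous_on UNIV (Psi D m \<psi>)"
  unfolding Psi_def
proof (intro continuous_on_sum)
  fix i
  have "continuous_on {0..} \<psi>" using \<psi> by (simp add: Theta_def)
  then show "continuous_on UNIV (\<lambda>x. \<psi> ((infdist x (D i))\<^sup>2))"
    by (rule continuous_on_compose2) (auto intro!: continuous_intros)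
qed

lemma Psi_grad_inner:
  "Psi_grad D m \<psi> x \<bullet> v =
     (\<Sum>i=1..m. right_deriv \<psi> ((infdist x (D i))\<^sup>2) * (2 * ((x - closest_point (D i) x) \<bullet> v)))"
  unfolding Psi_grad_def inner_sum_left by (simp add: algebra_simps)

text \<open>Termwise, the supergradient inequality for \<open>\<psi>\<close> is composed with
  \<open>sq_infdist_le\<close>. By concavity no slope exceeds the one at 0, so the curvature
  constant depends neither on \<open>x\<close> nor on \<open>y\<close>; this uniformity later yields
  one lower bound for all step sizes.\<close>

lemma Psi_le_quadratic:
  "Psi D m \<psi> y \<le> Psi D m \<psi> x + Psi_grad D m \<psi> x \<bullet> (y - x) + m * right_deriv \<psi> 0 * (norm (y - x))\<^sup>2"
proof -
  have "\<psi> ((infdist y (D i))\<^sup>2) \<le> \<psi> ((infdist x (D i))\<^sup>2)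
      + right_deriv \<psi> ((infdist x (D i))\<^sup>2) * (2 * ((x - closest_point (D i) x) \<bullet> (y - x)))
      + right_deriv \<psi> 0 * (norm (y - x))\<^sup>2" if i: "i \<in> {1..m}" for i
  proof -
    let ?a = "(infdist x (D i))\<^sup>2" and ?b = "(infdist y (D i))\<^sup>2"
    let ?s = "2 * ((x - closest_point (D i) x) \<bullet> (y - x))"
    have "\<psi> ?b \<le> \<psi> ?a + right_deriv \<psi> ?a * (?b - ?a)"
      by (rule Theta_supergradient[OF \<psi>]) auto
    also have "?b - ?a \<le> ?s + (norm (y - x))\<^sup>2"
      using sq_infdist_le[of "D i" y x] D[OF i] by simp
    finally have "\<psi> ?b \<le> \<psi> ?a + right_deriv \<psi> ?a * (?s + (norm (y - x))\<^sup>2)"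
      using Theta_right_deriv_nonneg[OF \<psi>] by (auto simp: mult_left_mono)
    moreover have "right_deriv \<psi> ?a * (norm (y - x))\<^sup>2 \<le> right_deriv \<psi> 0 * (norm (y - x))\<^sup>2"
      by (intro mult_right_mono Theta_right_deriv_antimono[OF \<psi>]) auto
    ultimately show ?thesis by (simp add: algebra_simps)
  qed
  then have "Psi D m \<psi> y \<le> (\<Sum>i=1..m. \<psi> ((infdist x (D i))\<^sup>2)
      + right_deriv \<psi> ((infdist x (D i))\<^sup>2) * (2 * ((x - closest_point (D i) x) \<bullet> (y - x)))
      + right_deriv \<psi> 0 * (norm (y - x))\<^sup>2)"
    unfolding Psi_def by (rule sum_mono)
  then show ?thesis
    by (simp add: sum.distrib Psi_grad_inner Psi_def)
qed

text \<open>Termwise, \<open>Theta_lower_quadratic\<close> is composed with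
  \<open>sq_infdist_ge\<close>. The error is quadratic in the change of the squared distance, which
  is linear in \<open>norm (y - x)\<close> only locally; hence the unit ball and a \<open>K\<close>
  that depends on \<open>x\<close>.\<close>

lemma Psi_ge_quadratic:
  obtains K where "\<And>y. dist y x < 1 \<Longrightarrow>
    Psi D m \<psi> x + Psi_grad D m \<psi> x \<bullet> (y - x) - K * (norm (y - x))\<^sup>2 \<le> Psi D m \<psi> y"
proof -
  obtain L where L: "L-lipschitz_on {0..} (right_deriv \<psi>)" using \<psi> by (auto simp: Theta_def)
  have L0: "L \<ge> 0" using lipschitz_on_nonneg[OF L] .
  \<comment> \<open>On the unit ball the difference of the squared distances, factored as difference
    times sum, is at most \<open>norm (y - x)\<close> times
    \<open>2 * infdist x (D i) + 1\<close>.\<close>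
  let ?K = "\<Sum>i=1..m. L * (2 * infdist x (D i) + 1)\<^sup>2"
  show thesis
  proof (rule that[of ?K])
    fix y assume y: "dist y x < 1"
    have "\<psi> ((infdist x (D i))\<^sup>2)
      + right_deriv \<psi> ((infdist x (D i))\<^sup>2) * (2 * ((x - closest_point (D i) x) \<bullet> (y - x)))
      - L * (2 * infdist x (D i) + 1)\<^sup>2 * (norm (y - x))\<^sup>2 \<le> \<psi> ((infdist y (D i))\<^sup>2)"
      if i: "i \<in> {1..m}" for i
    proof -
      let ?a = "(infdist x (D i))\<^sup>2" and ?b = "(infdist y (D i))\<^sup>2"
      have "right_deriv \<psi> ?a * (2 * ((x - closest_point (D i) x) \<bullet> (y - x))) \<le> right_deriv \<psi> ?a * (?b - ?a)"
        using sq_infdist_ge[of "D i" x y] D[OF i] Theta_right_deriv_nonneg[OF \<psi>]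
        by (intro mult_left_mono) auto
      moreover have "(?b - ?a)\<^sup>2 \<le> ((2 * infdist x (D i) + 1) * norm (y - x))\<^sup>2"
      proof (rule power2_le_iff_abs_le[THEN iffD2])
        have d: "\<bar>infdist y (D i) - infdist x (D i)\<bar> \<le> norm (y - x)"
          using infdist_triangle_abs[of y "D i" x] by (simp add: dist_norm)
        then have "infdist y (D i) + infdist x (D i) \<le> 2 * infdist x (D i) + 1"
          using y by (simp add: dist_norm)
        then have "\<bar>infdist y (D i) - infdist x (D i)\<bar> * \<bar>infdist y (D i) + infdist x (D i)\<bar>
            \<le> norm (y - x) * (2 * infdist x (D i) + 1)"
          using d infdist_nonneg[of y "D i"] infdist_nonneg[of x "D i"]
          by (intro mult_mono) auto
        then show "\<bar>?b - ?a\<bar> \<le> (2 * infdist x (D i) + 1) * norm (y - x)"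
          by (simp add: abs_mult[symmetric] power2_eq_square algebra_simps)
        show "0 \<le> (2 * infdist x (D i) + 1) * norm (y - x)"
          using infdist_nonneg[of x "D i"] by simp
      qed
      then have "L * (?b - ?a)\<^sup>2 \<le> L * (2 * infdist x (D i) + 1)\<^sup>2 * (norm (y - x))\<^sup>2"
        using mult_left_mono[OF _ L0] by (simp add: power_mult_distrib mult.assoc)
      ultimately show ?thesis
        using Theta_lower_quadratic[OF \<psi> L, of ?a ?b] by simp
    qed
    then have "(\<Sum>i=1..m. \<psi> ((infdist x (D i))\<^sup>2)
      + right_deriv \<psi> ((infdist x (D i))\<^sup>2) * (2 * ((x - closest_point (D i) x) \<bullet> (y - x)))
      - L * (2 * infdist x (D i) + 1)\<^sup>2 * (norm (y - x))\<^sup>2) \<le> Psi D m \<psi> y"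
      unfolding Psi_def by (rule sum_mono)
    then show "Psi D m \<psi> x + Psi_grad D m \<psi> x \<bullet> (y - x) - ?K * (norm (y - x))\<^sup>2 \<le> Psi D m \<psi> y"
      by (simp add: sum.distrib sum_subtractf Psi_grad_inner Psi_def sum_distrib_right)
  qed
qed

text \<open>Each summand is a product of a slope and a residual. Both factors are Lipschitz and
  bounded on a bounded set, so the product rule for Lipschitz functions applies.\<close>

lemma Psi_grad_lipschitz_on_bounded:
  assumes "bounded S"
  obtains L where "L-lipschitz_on S (Psi_grad D m \<psi>)"
proof -
  obtain Lp where Lp: "Lp-lipschitz_on {0..} (right_deriv \<psi>)" using \<psi> by (auto simp: Theta_def)
  have "\<exists>L. L-lipschitz_on S (\<lambda>x. (2 * right_deriv \<psi> ((infdist x (D i))\<^sup>2)) *\<^sub>R (x - closest_point (D i) x))"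
    if i: "i \<in> {1..m}" for i
  proof -
    note Di = D[OF i]
    obtain x0 where "x0 \<in> D i" using Di by auto
    moreover obtain B where B: "\<And>x. x \<in> S \<Longrightarrow> dist x x0 \<le> B"
      using assms bounded_any_center[of S x0] by (auto simp: dist_commute)
    ultimately have R: "infdist x (D i) \<le> B" if "x \<in> S" for x
      using infdist_le[of x0 "D i" x] that by force
    \<comment> \<open>The maximum with 0 keeps \<open>R\<close> nonnegative even when
      \<open>S\<close> is empty.\<close>
    define R where "R = max B 0"
    have R: "infdist x (D i) \<le> R" if "x \<in> S" for x using R[OF that] by (simp add: R_def)
    have R0: "0 \<le> R" by (simp add: R_def)
    have Lp0: "0 \<le> Lp" using lipschitz_on_nonneg[OF Lp] .
    let ?p = "\<lambda>x. right_deriv \<psi> ((infdist x (D i))\<^sup>2)" and ?q = "\<lambda>x. x - closest_point (D i) x"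
    \<comment> \<open>Product rule: the residual has Lipschitz constant 2 (identity plus a
      nonexpansive projection) and norm at most \<open>R\<close>, while the slope is at most
      \<open>right_deriv \<psi> 0\<close> and has constant \<open>2 * Lp * R\<close>. The factor 2
      of the summand gives the stated sum.\<close>
    have est: "norm ((2 * ?p x) *\<^sub>R ?q x - (2 * ?p y) *\<^sub>R ?q y) \<le> (4 * right_deriv \<psi> 0 + 4 * Lp * R * R) * norm (x - y)"
      if xy: "x \<in> S" "y \<in> S" for x y
    proof -
      have q: "norm (?q x - ?q y) \<le> 2 * norm (x - y)"
        using norm_triangle_ineq4[of "x - y" "closest_point (D i) x - closest_point (D i) y"]
          closest_point_lipschitz[of "D i" x y] Di by (simp add: dist_norm algebra_simps)
      have p0: "0 \<le> ?p x" "?p x \<le> right_deriv \<psi> 0"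
        using Theta_right_deriv_nonneg[OF \<psi>] Theta_right_deriv_antimono[OF \<psi>] by auto
      have qy: "norm (?q y) \<le> R" using R[OF xy(2)] Di by (simp add: infdist_eq_closest_point)
      have d: "\<bar>infdist x (D i) - infdist y (D i)\<bar> \<le> norm (x - y)"
        using infdist_triangle_abs[of x "D i" y] by (simp add: dist_norm)
      have "\<bar>(infdist x (D i))\<^sup>2 - (infdist y (D i))\<^sup>2\<bar>
          = \<bar>infdist x (D i) - infdist y (D i)\<bar> * \<bar>infdist x (D i) + infdist y (D i)\<bar>"
        by (simp add: abs_mult[symmetric] power2_eq_square algebra_simps)
      also have "\<dots> \<le> norm (x - y) * (2 * R)"
        using d R[OF xy(1)] R[OF xy(2)] infdist_nonneg[of y "D i"] infdist_nonneg[of x "D i"]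
        by (intro mult_mono) auto
      finally have "Lp * \<bar>(infdist x (D i))\<^sup>2 - (infdist y (D i))\<^sup>2\<bar> \<le> Lp * (norm (x - y) * (2 * R))"
        using Lp0 by (rule mult_left_mono)
      then have "\<bar>?p x - ?p y\<bar> \<le> Lp * (norm (x - y) * (2 * R))"
        using lipschitz_onD[OF Lp, of "(infdist x (D i))\<^sup>2" "(infdist y (D i))\<^sup>2"]
        by (simp add: dist_real_def)
      then have "\<bar>?p x - ?p y\<bar> * norm (?q y) \<le> Lp * (norm (x - y) * (2 * R)) * R"
        using qy R0 Lp0 by (intro mult_mono) auto
      moreover have "?p x * norm (?q x - ?q y) \<le> right_deriv \<psi> 0 * (2 * norm (x - y))"
        using p0 q by (intro mult_mono) auto
      moreover have "(2 * ?p x) *\<^sub>R ?q x - (2 * ?p y) *\<^sub>R ?q y = 2 *\<^sub>R (?p x *\<^sub>R (?q x - ?q y) + (?p x - ?p y) *\<^sub>R ?q y)"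
        by (simp add: algebra_simps scaleR_2[symmetric])
      then have "norm ((2 * ?p x) *\<^sub>R ?q x - (2 * ?p y) *\<^sub>R ?q y) \<le> 2 * (?p x * norm (?q x - ?q y) + \<bar>?p x - ?p y\<bar> * norm (?q y))"
        using norm_triangle_ineq[of "?p x *\<^sub>R (?q x - ?q y)" "(?p x - ?p y) *\<^sub>R ?q y"] p0 by simp
      ultimately show ?thesis by (simp add: algebra_simps)
    qed
    show ?thesis
      by (rule exI[of _ "4 * right_deriv \<psi> 0 + 4 * Lp * R * R"], rule lipschitz_onI)
         (use est R0 Lp0 Theta_right_deriv_0(2)[OF \<psi>] in \<open>auto simp: dist_norm\<close>)
  qed
  then obtain L where L: "\<And>i. i \<in> {1..m} \<Longrightarrow>
     (L i)-lipschitz_on S (\<lambda>x. (2 * right_deriv \<psi> ((infdist x (D i))\<^sup>2)) *\<^sub>R (x - closest_point (D i) x))"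
    by metis
  show thesis
  proof (rule that, rule lipschitz_onI)
    show "0 \<le> (\<Sum>i=1..m. L i)" using L lipschitz_on_nonneg by (intro sum_nonneg) blast
    fix x y assume "x \<in> S" "y \<in> S"
    then show "dist (Psi_grad D m \<psi> x) (Psi_grad D m \<psi> y) \<le> (\<Sum>i=1..m. L i) * dist x y"
      unfolding Psi_grad_def dist_norm sum_subtractf[symmetric] sum_distrib_right
      using lipschitz_onD[OF L] by (intro sum_norm_le) (simp add: dist_norm)
  qed
qed

lemma continuous_Psi_grad: "continuous (at x) (Psi_grad D m \<psi>)"
proof -
  obtain L where "L-lipschitz_on (ball x 1) (Psi_grad D m \<psi>)"
    using Psi_grad_lipschitz_on_bounded bounded_ball by blast
  then show ?thesis
    using lipschitz_on_continuous_on continuous_on_eq_continuous_at[of "ball x 1"] by fastforce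
qed

text \<open>An unbounded sequence in the level set, normalised, clusters at a unit vector
  \<open>v\<close> in the horizon cone of \<open>C\<close>. Level-boundedness of
  \<open>\<psi>\<close> bounds the distances to each \<open>D i\<close>, so the projections rescaled
  by the same factors also tend to \<open>v\<close>, which contradicts the horizon
  condition.\<close>

lemma bounded_level_set:
  assumes hor: "horizon_cone C \<inter> (\<Inter>i\<in>{1..m}. horizon_cone (D i)) \<subseteq> {0}"
  shows "bounded {x \<in> C. Psi D m \<psi> x \<le> \<gamma>}"
proof (rule ccontr)
  assume unb: "\<not> ?thesis"
  \<comment> \<open>The summand 1 makes all norms positive and gives the bound by
    \<open>inverse (real (Suc n))\<close> below.\<close>
  have "\<exists>x. x \<in> C \<and> Psi D m \<psi> x \<le> \<gamma> \<and> real n + 1 < norm x" for n :: nat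
    using unb unfolding bounded_iff by (metis (mono_tags, lifting) mem_Collect_eq not_le)
  then obtain X where X: "\<And>n. X n \<in> C" "\<And>n. Psi D m \<psi> (X n) \<le> \<gamma>" "\<And>n. real n + 1 < norm (X n)"
    by metis
  define Z where "Z n = (1 / norm (X n)) *\<^sub>R X n" for n
  have nz: "norm (X n) > 0" for n using X(3)[of n] by linarith
  have "\<forall>n. Z n \<in> sphere 0 1" using nz by (simp add: Z_def)
  then obtain v r where v: "v \<in> sphere 0 1" and r: "strict_mono r" "(Z \<circ> r) \<longlonglongrightarrow> v"
    using compact_sphere[of "0::'a" 1] unfolding compact_def by blast
  define lam where "lam n = 1 / norm (X (r n))" for n
  have lam0: "lam n > 0" for n using nz by (simp add: lam_def)
  have lam: "lam \<longlonglongrightarrow> 0"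
  proof (rule tendsto_sandwich[OF _ _ tendsto_const LIMSEQ_inverse_real_of_nat])
    show "\<forall>\<^sub>F n in sequentially. 0 \<le> lam n" using lam0 by (auto intro: always_eventually less_imp_le)
    have "lam n \<le> inverse (real (Suc n))" for n
    proof -
      have "real (Suc n) \<le> norm (X (r n))"
        using X(3)[of "r n"] seq_suble[OF r(1), of n] by simp
      then show ?thesis unfolding lam_def by (simp add: inverse_eq_divide frac_le)
    qed
    then show "\<forall>\<^sub>F n in sequentially. lam n \<le> inverse (real (Suc n))" by simp
  qed
  have limX: "(\<lambda>n. lam n *\<^sub>R X (r n)) \<longlonglongrightarrow> v"
    using r(2) by (simp add: o_def Z_def lam_def)
  then have "v \<in> horizon_cone C"
    unfolding horizon_cone_def using X(1) lam0 lam
    by (auto intro!: exI[of _ "\<lambda>n. X (r n)"] exI[of _ lam])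
  moreover have "v \<in> horizon_cone (D i)" if i: "i \<in> {1..m}" for i
  proof -
    have "bounded {s. 0 \<le> s \<and> \<psi> s \<le> \<gamma>}" using \<psi> by (simp add: Theta_def)
    then obtain B where B: "\<And>s. 0 \<le> s \<Longrightarrow> \<psi> s \<le> \<gamma> \<Longrightarrow> \<bar>s\<bar> \<le> B"
      unfolding bounded_iff by auto
    have d: "infdist (X n) (D i) \<le> sqrt B" for n
    proof -
      have "\<psi> ((infdist (X n) (D i))\<^sup>2) \<le> Psi D m \<psi> (X n)"
        unfolding Psi_def using \<psi> i by (intro member_le_sum) (auto simp: Theta_def)
      then have "(infdist (X n) (D i))\<^sup>2 \<le> B" using B[of "(infdist (X n) (D i))\<^sup>2"] X(2)[of n] by simp
      then show ?thesis by (rule real_le_rsqrt)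
    qed
    define Y where "Y n = closest_point (D i) (X (r n))" for n
    have "(\<lambda>n. lam n *\<^sub>R (X (r n) - Y n)) \<longlonglongrightarrow> 0"
    proof (rule Lim_null_comparison)
      show "\<forall>\<^sub>F n in sequentially. norm (lam n *\<^sub>R (X (r n) - Y n)) \<le> lam n * sqrt B"
      proof (intro always_eventually allI)
        fix n
        have "norm (X (r n) - Y n) \<le> sqrt B"
          using d[of "r n"] D[OF i] by (simp add: infdist_eq_closest_point Y_def)
        then show "norm (lam n *\<^sub>R (X (r n) - Y n)) \<le> lam n * sqrt B"
          using lam0[of n] by simp
      qed
      show "(\<lambda>n. lam n * sqrt B) \<longlonglongrightarrow> 0" using tendsto_mult_left_zero[OF lam] .
    qed
    from tendsto_diff[OF limX this] have "(\<lambda>n. lam n *\<^sub>R Y n) \<longlonglongrightarrow> v"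
      by (simp add: scaleR_diff_right)
    moreover have "Y n \<in> D i" for n using D[OF i] by (simp add: Y_def closest_point_in_set)
    ultimately show ?thesis
      unfolding horizon_cone_def using lam0 lam by (auto intro!: exI[of _ Y] exI[of _ lam])
  qed
  ultimately have "v = 0" using hor by blast
  with v show False by simp
qed

end

section \<open>Proximal subgradients\<close>

text \<open>Proximal subgradients are regular: the difference quotient is at least
  \<open>- K * norm (y - x)\<close>, which tends to 0.\<close>

lemma regular_subdiffI_quadratic:
  fixes f :: "'a::euclidean_space \<Rightarrow> ereal"
  assumes fx: "f x = ereal c" and r: "0 < r"
    and lb: "\<And>y. dist y x < r \<Longrightarrow> ereal (c + v \<bullet> (y - x) - K * (norm (y - x))\<^sup>2) \<le> f y"
  shows "v \<in> regular_subdiff f x"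
proof -
  let ?q = "\<lambda>y. (f y - f x - ereal (v \<bullet> (y - x))) / ereal (norm (y - x))"
  let ?h = "\<lambda>y. - K * norm (y - x)"
  have "(?h \<longlongrightarrow> 0) (at x)"
    by (auto intro!: tendsto_eq_intros)
  then have "((\<lambda>y. ereal (?h y)) \<longlongrightarrow> 0) (at x)"
    by (simp add: zero_ereal_def)
  then have "0 = Liminf (at x) (\<lambda>y. ereal (?h y))"
    by (intro lim_imp_Liminf[symmetric]) auto
  also have "\<dots> \<le> Liminf (at x) ?q"
  proof (rule Liminf_mono)
    \<comment> \<open>The lower bound excludes the value \<open>-\<infinity>\<close>, so a nonreal
      \<open>f y\<close> makes the quotient infinite and the claim trivial.\<close>
    have "ereal (?h y) \<le> ?q y" if y: "y \<noteq> x" "dist y x < r" for y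
    proof (cases "f y")
      case (real s)
      have n: "norm (y - x) > 0" using y by simp
      have "- K * (norm (y - x))\<^sup>2 \<le> s - c - v \<bullet> (y - x)" using lb[OF y(2)] real by simp
      then have "- K * norm (y - x) \<le> (s - c - v \<bullet> (y - x)) / norm (y - x)"
        using n by (simp add: pos_le_divide_eq power2_eq_square)
      then show ?thesis using real fx n by simp
    qed (use lb[OF y(2)] fx y in auto)
    then show "\<forall>\<^sub>F y in at x. ereal (?h y) \<le> ?q y"
      unfolding eventually_at using r by blast
  qed
  finally show ?thesis
    using fx by (simp add: regular_subdiff_def edom_def)
qed

lemma regular_subdiff_subset_subdiff: "regular_subdiff f x \<subseteq> subdiff f x"
proof
  fix v assume "v \<in> regular_subdiff f x"
  show "v \<in> subdiff f x"
    unfolding subdiff_def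
  proof (intro CollectI conjI exI allI)
    show "x \<in> edom f" using \<open>v \<in> regular_subdiff f x\<close> by (simp add: regular_subdiff_def)
    show "(\<lambda>_. x) \<longlonglongrightarrow> x" "(\<lambda>_. f x) \<longlonglongrightarrow> f x" "(\<lambda>_. v) \<longlonglongrightarrow> v" by simp_all
  qed fact
qed

section \<open>Convergence of descent sequences under the Kurdyka-Lojasiewicz property\<close>

text \<open>The KL inequality at \<open>x (Suc t)\<close>, tested with \<open>w t\<close>, bounds
  the slope of \<open>\<phi>\<close> from below by the inverse of the last step length. By
  concavity, descent of \<open>F\<close> becomes descent of \<open>\<phi>\<close> along the gaps
  \<open>e\<close>, and the step lengths telescope as long as the iterates stay in
  \<open>U\<close>.\<close>

lemma KL_descent_sequence_convergent:
  fixes f :: "'a::real_inner \<Rightarrow> ereal"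
  assumes KL: "KL_property_at f xh" and fx: "\<And>t. f (x t) = ereal (F t)" "f xh = ereal Fh"
    and ab: "0 < a" "0 < b"
    and descent: "\<And>t. F (Suc t) + a * (norm (x (Suc t) - x t))\<^sup>2 \<le> F t"
    and w: "\<And>t. w t \<in> subdiff f (x (Suc t))" "\<And>t. norm (w t) \<le> b * norm (x (Suc t) - x t)"
    and step0: "(\<lambda>t. norm (x (Suc t) - x t)) \<longlonglongrightarrow> 0"
    and r: "strict_mono r" "(x \<circ> r) \<longlonglongrightarrow> xh" and F: "F \<longlonglongrightarrow> Fh"
  shows "x \<longlonglongrightarrow> xh"
proof -
  obtain U \<nu> \<phi> where U: "open U" "xh \<in> U" and \<nu>: "0 < \<nu>" and \<phi>: "KL_desingularizer \<nu> \<phi>"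
    and KLU: "\<And>y. y \<in> U \<Longrightarrow> f xh < f y \<Longrightarrow> f y < f xh + \<nu> \<Longrightarrow>
      1 \<le> ereal (deriv \<phi> (real_of_ereal (f y - f xh))) * (INF v\<in>subdiff f y. ereal (norm v))"
    using KL unfolding KL_property_at_def by blast
  define e where "e t = F t - Fh" for t
  define \<delta> where "\<delta> t = norm (x (Suc t) - x t)" for t
  \<comment> \<open>Chosen so that the combined estimate reads \<open>(\<delta> (Suc t))\<^sup>2
    \<le> 2 * K * ?\<Delta> * \<delta> t\<close>.\<close>
  define K where "K = b / (2 * a)"
  have K: "0 < K" using ab by (simp add: K_def)
  have \<delta>0: "0 \<le> \<delta> t" for t by (simp add: \<delta>_def)
  have desc: "a * (\<delta> t)\<^sup>2 \<le> e t - e (Suc t)" for t using descent[of t] by (simp add: e_def \<delta>_def)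
  have "F (Suc t) \<le> F t" for t
  proof -
    have "0 \<le> a * (\<delta> t)\<^sup>2" using ab by simp
    then show ?thesis using desc[of t] by (simp add: e_def)
  qed
  then have "decseq F" by (simp add: decseq_Suc_iff)
  then have e0: "0 \<le> e t" for t using decseq_ge[OF _ F] by (simp add: e_def)
  have elim: "e \<longlonglongrightarrow> 0" unfolding e_def using tendsto_diff[OF F tendsto_const[of Fh]] by simp
  have \<phi>0: "0 \<le> \<phi> (e t)" if "ereal (e t) < \<nu>" for t
    using \<phi> e0 that by (simp add: KL_desingularizer_def)
  have e_mono: "ereal (e (Suc t)) < \<nu>" if "ereal (e t) < \<nu>" for t
  proof -
    have "e (Suc t) \<le> e t" using \<open>decseq F\<close> by (simp add: e_def decseq_Suc_iff)
    then show ?thesis using that by (meson ereal_less_eq(3) le_less_trans)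
  qed
  have step: "\<delta> (Suc t) \<le> \<delta> t / 2 + K * (\<phi> (e (Suc t)) - \<phi> (e (Suc (Suc t))))"
    if xU: "x (Suc t) \<in> U" and e\<nu>: "ereal (e (Suc t)) < \<nu>" for t
  proof (cases "e (Suc t) = 0")
    case True
    \<comment> \<open>With the gap closed, no further descent is possible, so the step vanishes and
      the \<open>\<phi>\<close> terms cancel.\<close>
    have nonneg: "0 \<le> a * (\<delta> (Suc t))\<^sup>2" using ab by simp
    then have "e (Suc (Suc t)) = 0" "a * (\<delta> (Suc t))\<^sup>2 = 0"
      using True desc[of "Suc t"] e0[of "Suc (Suc t)"] by linarith+
    then show ?thesis using True ab \<delta>0[of t] by simp
  next
    case False
    then have pos: "0 < e (Suc t)" using e0[of "Suc t"] by simp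
    let ?d = "deriv \<phi> (e (Suc t))" and ?\<Delta> = "\<phi> (e (Suc t)) - \<phi> (e (Suc (Suc t)))"
    have d: "0 < ?d" using \<phi> pos e\<nu> by (simp add: KL_desingularizer_def)
    have lt: "f xh < f (x (Suc t))" "f (x (Suc t)) < f xh + \<nu>"
      using pos e\<nu> \<nu> unfolding fx e_def by (simp, cases \<nu>) auto
    have "1 \<le> ereal ?d * (INF v\<in>subdiff f (x (Suc t)). ereal (norm v))"
      using KLU[OF xU lt] by (simp add: fx e_def)
    also have "\<dots> \<le> ereal ?d * ereal (norm (w t))"
      using d w(1) by (intro ereal_mult_left_mono INF_lower) auto
    finally have "1 \<le> ?d * norm (w t)" by (simp add: one_ereal_def)
    also have "\<dots> \<le> ?d * (b * \<delta> t)"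
      using d w(2)[of t] by (simp add: \<delta>_def)
    finally have one: "1 \<le> ?d * (b * \<delta> t)" .
    have "\<phi> (e (Suc (Suc t))) \<le> \<phi> (e (Suc t)) + ?d * (e (Suc (Suc t)) - e (Suc t))"
      by (rule KL_desingularizer_below_tangent[OF \<phi> pos e\<nu> e0 e_mono[OF e\<nu>]])
    moreover have "?d * (a * (\<delta> (Suc t))\<^sup>2) \<le> ?d * (e (Suc t) - e (Suc (Suc t)))"
      using d desc[of "Suc t"] by simp
    ultimately have \<Delta>: "?d * (a * (\<delta> (Suc t))\<^sup>2) \<le> ?\<Delta>" by (simp add: algebra_simps)
    have \<Delta>0: "0 \<le> ?\<Delta>" using d ab by (intro order_trans[OF _ \<Delta>]) simp
    \<comment> \<open>The unknown slope \<open>?d\<close> is eliminated by multiplying its lower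
      bound \<open>one\<close> with the descent estimate \<open>\<Delta>\<close>.\<close>
    have "a * (\<delta> (Suc t))\<^sup>2 * 1 \<le> a * (\<delta> (Suc t))\<^sup>2 * (?d * (b * \<delta> t))"
      using one ab by (intro mult_left_mono) auto
    also have "\<dots> = ?d * (a * (\<delta> (Suc t))\<^sup>2) * (b * \<delta> t)" by simp
    also have "\<dots> \<le> ?\<Delta> * (b * \<delta> t)"
      using \<Delta> ab \<delta>0 by (intro mult_right_mono) auto
    finally have "(\<delta> (Suc t))\<^sup>2 \<le> 2 * K * ?\<Delta> * \<delta> t"
      using ab by (simp add: K_def field_simps)
    \<comment> \<open>Arithmetic-geometric mean inequality for \<open>\<delta> t / 2\<close> and
      \<open>K * ?\<Delta>\<close>.\<close>
    also have "\<dots> \<le> (\<delta> t / 2 + K * ?\<Delta>)\<^sup>2"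
      using zero_le_power2[of "\<delta> t / 2 - K * ?\<Delta>"] by (simp add: power2_eq_square algebra_simps)
    finally show ?thesis
      by (rule power2_le_imp_le) (use \<delta>0 K \<Delta>0 in auto)
  qed
  have \<phi>lim: "(\<lambda>t. \<phi> (e t)) \<longlonglongrightarrow> 0" and e\<nu>: "\<forall>\<^sub>F t in sequentially. ereal (e t) < \<nu>"
  proof -
    have "(\<lambda>t. ereal (e t)) \<longlonglongrightarrow> 0" using elim by (simp add: zero_ereal_def)
    then show ev: "\<forall>\<^sub>F t in sequentially. ereal (e t) < \<nu>" using \<nu> by (rule order_tendstoD)
    have "continuous_on {s. 0 \<le> s \<and> ereal s < \<nu>} \<phi>" using \<phi> by (simp add: KL_desingularizer_def)
    from continuous_on_tendsto_compose[OF this elim] ev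
    have "(\<lambda>t. \<phi> (e t)) \<longlonglongrightarrow> \<phi> 0" using \<nu> e0 by (simp add: zero_ereal_def)
    then show "(\<lambda>t. \<phi> (e t)) \<longlonglongrightarrow> 0" using \<phi> by (simp add: KL_desingularizer_def)
  qed
  show ?thesis
  proof (rule metric_LIMSEQ_I)
    fix \<epsilon> :: real assume "0 < \<epsilon>"
    obtain \<rho>' where \<rho>': "\<rho>' > 0" "ball xh \<rho>' \<subseteq> U" using U open_contains_ball by blast
    define \<rho> where "\<rho> = min \<epsilon> \<rho>'"
    have \<rho>: "0 < \<rho>" "\<rho> \<le> \<epsilon>" "ball xh \<rho> \<subseteq> U"
      using \<open>0 < \<epsilon>\<close> \<rho>' by (auto simp: \<rho>_def)
    \<comment> \<open>Budget for the radius \<open>\<rho>\<close>: a quarter each for the starting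
      distance to \<open>xh\<close>, the first step, and twice more for the later path, whose length
      is bounded by \<open>\<delta> N\<close> plus the \<open>\<phi>\<close> term.\<close>
    have "(\<lambda>t. 2 * K * \<phi> (e (Suc t))) \<longlonglongrightarrow> 0"
      using tendsto_mult_right_zero[OF LIMSEQ_Suc[OF \<phi>lim]] .
    then have "\<forall>\<^sub>F t in sequentially. 2 * K * \<phi> (e (Suc t)) < \<rho> / 4"
      by (rule order_tendstoD) (use \<rho> in simp)
    moreover have "\<forall>\<^sub>F t in sequentially. \<delta> t < \<rho> / 4"
      unfolding \<delta>_def by (rule order_tendstoD[OF step0]) (use \<rho> in simp)
    ultimately have "\<forall>\<^sub>F t in sequentially. \<delta> t < \<rho> / 4 \<and> 2 * K * \<phi> (e (Suc t)) < \<rho> / 4 \<and> ereal (e t) < \<nu>"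
      using e\<nu> by eventually_elim simp
    then obtain N0 where N0: "\<And>t. t \<ge> N0 \<Longrightarrow> \<delta> t < \<rho> / 4 \<and> 2 * K * \<phi> (e (Suc t)) < \<rho> / 4 \<and> ereal (e t) < \<nu>"
      unfolding eventually_sequentially by blast
    obtain N1 where N1: "\<And>k. k \<ge> N1 \<Longrightarrow> dist (x (r k)) xh < \<rho> / 4"
      using metric_LIMSEQ_D[OF r(2), of "\<rho> / 4"] \<rho> by auto
    \<comment> \<open>Since \<open>r k \<ge> k\<close>, this index lies both in the tail given by
      \<open>N0\<close> and on the subsequence close to \<open>xh\<close>.\<close>
    define N where "N = r (max N0 N1)"
    have NN0: "N \<ge> N0" using seq_suble[OF r(1), of "max N0 N1"] by (simp add: N_def)
    note small = N0[OF NN0]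
    have "dist (x N) xh < \<rho> / 4" using N1 by (simp add: N_def)
    then have near: "dist (x (Suc N)) xh < \<rho> / 2"
      using small dist_triangle[of "x (Suc N)" xh "x N"] by (simp add: \<delta>_def dist_norm)
    \<comment> \<open>Keeping the current step length on the left closes the induction: the new step
      is counted twice, and twice the recursion costs one old step plus the \<open>\<phi>\<close>
      difference. The second conjunct keeps the iterate in \<open>U\<close>, where the recursion is
      available.\<close>
    have inv: "dist (x (Suc N + k)) (x (Suc N)) + \<delta> (N + k)
        \<le> \<delta> N + 2 * K * (\<phi> (e (Suc N)) - \<phi> (e (Suc N + k)))
      \<and> dist (x (Suc N + k)) xh < \<rho>" for k
    proof (induction k)
      case 0
      then show ?case using near \<rho> by simp
    next
      case (Suc k)
      have "x (Suc (N + k)) \<in> U" using Suc \<rho>(3) by (auto simp: dist_commute)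
      moreover have "ereal (e (Suc (N + k))) < \<nu>" using N0[of "Suc (N + k)"] NN0 by simp
      ultimately have "\<delta> (Suc (N + k)) \<le> \<delta> (N + k) / 2 + K * (\<phi> (e (Suc (N + k))) - \<phi> (e (Suc (Suc (N + k)))))"
        by (rule step)
      moreover have "dist (x (Suc N + Suc k)) (x (Suc N)) \<le> \<delta> (Suc (N + k)) + dist (x (Suc N + k)) (x (Suc N))"
        using dist_triangle[of "x (Suc N + Suc k)" "x (Suc N)" "x (Suc N + k)"] by (simp add: \<delta>_def dist_norm)
      ultimately have first: "dist (x (Suc N + Suc k)) (x (Suc N)) + \<delta> (N + Suc k)
        \<le> \<delta> N + 2 * K * (\<phi> (e (Suc N)) - \<phi> (e (Suc N + Suc k)))"
        using Suc by (simp add: algebra_simps)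
      have "0 \<le> \<phi> (e (Suc N + Suc k))" using N0[of "Suc N + Suc k"] NN0 by (intro \<phi>0) simp
      then have "2 * K * (\<phi> (e (Suc N)) - \<phi> (e (Suc N + Suc k))) \<le> 2 * K * \<phi> (e (Suc N))"
        using K by simp
      then have "dist (x (Suc N + Suc k)) (x (Suc N)) < \<rho> / 2"
        using first small \<delta>0[of "N + Suc k"] by linarith
      then have "dist (x (Suc N + Suc k)) xh < \<rho>"
        using near dist_triangle[of "x (Suc N + Suc k)" xh "x (Suc N)"] by linarith
      with first show ?case by blast
    qed
    show "\<exists>no. \<forall>n\<ge>no. dist (x n) xh < \<epsilon>"
    proof (intro exI allI impI)
      fix n assume "Suc N \<le> n"
      then obtain k where "n = Suc N + k" using le_Suc_ex by blast
      then show "dist (x n) xh < \<epsilon>" using inv[of k] \<rho>(2) by simp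
    qed
  qed
qed

section \<open>The line search\<close>

lemma trial_pointsD:
  assumes "u \<in> trial_points C x g \<alpha>" "y \<in> C"
  shows "u \<in> C"
    and "g \<bullet> (u - x) + 1 / (2 * \<alpha>) * (norm (u - x))\<^sup>2 \<le> g \<bullet> (y - x) + 1 / (2 * \<alpha>) * (norm (y - x))\<^sup>2"
  using assms unfolding trial_points_def is_arg_min_def by (auto simp: not_less)

text \<open>Global minimality against \<open>y\<close>, with the square expanded around
  \<open>u\<close>. The quadratic remainder makes this a proximal normal inequality, which suits a
  nonconvex \<open>C\<close>.\<close>

lemma trial_points_optimality:
  assumes "u \<in> trial_points C x g \<alpha>" "y \<in> C"
  shows "0 \<le> (g + (1 / \<alpha>) *\<^sub>R (u - x)) \<bullet> (y - u) + 1 / (2 * \<alpha>) * (norm (y - u))\<^sup>2"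
proof -
  have expand: "(norm (y - x))\<^sup>2 = (norm (y - u))\<^sup>2 + 2 * ((u - x) \<bullet> (y - u)) + (norm (u - x))\<^sup>2"
    unfolding power2_norm_eq_inner by (simp add: inner_diff_left inner_diff_right inner_commute)
  have "1 / (2 * \<alpha>) * (norm (y - x))\<^sup>2 =
      1 / (2 * \<alpha>) * (norm (y - u))\<^sup>2 + (1 / \<alpha>) * ((u - x) \<bullet> (y - u)) + 1 / (2 * \<alpha>) * (norm (u - x))\<^sup>2"
    unfolding expand by (simp add: distrib_left)
  moreover have "g \<bullet> (y - x) = g \<bullet> (y - u) + g \<bullet> (u - x)" by (simp add: inner_diff_right)
  ultimately show ?thesis
    using trial_pointsD(2)[OF assms] by (simp add: inner_add_left)
qed

text \<open>A step size of at most \<open>A\<close> is never rejected, so any rejected one exceeds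
  \<open>A\<close> and its successor exceeds \<open>\<eta> * A\<close>.\<close>

lemma line_search_step_bound:
  assumes "line_search C F \<eta> \<sigma> R x g \<alpha> u" "0 < \<alpha>" "0 < \<eta>"
    and acc: "\<And>\<alpha> v. 0 < \<alpha> \<Longrightarrow> \<alpha> \<le> A \<Longrightarrow> v \<in> trial_points C x g \<alpha> \<Longrightarrow>
      F v - R \<le> - (\<sigma> / 2) * (norm (v - x))\<^sup>2"
  shows "\<exists>\<beta>\<ge>min \<alpha> (\<eta> * A). u \<in> trial_points C x g \<beta> \<and> F u - R \<le> - (\<sigma> / 2) * (norm (u - x))\<^sup>2"
  using assms(1,2)
proof induction
  case (accept u \<alpha>)
  then show ?case by (intro exI[of _ \<alpha>]) auto
next
  case (backtrack v \<alpha> u)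
  then have "A < \<alpha>" using acc not_le by blast
  then have "min \<alpha> (\<eta> * A) \<le> min (\<eta> * \<alpha>) (\<eta> * A)" using \<open>0 < \<eta>\<close> by simp
  moreover have "0 < \<eta> * \<alpha>" using \<open>0 < \<alpha>\<close> \<open>0 < \<eta>\<close> by simp
  ultimately show ?case using backtrack.IH by (meson order_trans)
qed

section \<open>Convergence of the algorithm\<close>

theorem theorem5p1:
  fixes C :: "(real ^ 'n) set"
    and D :: "nat \<Rightarrow> (real ^ 'n) set"
    and m :: nat
    and \<psi> :: "real \<Rightarrow> real"
    and \<alpha>min \<alpha>max \<eta> \<sigma> :: real
    and x :: "nat \<Rightarrow> real ^ 'n"
  assumes "C \<noteq> {}" and "closed C"
    and "m \<ge> 1"
    and "\<And>i. i \<in> {1..m} \<Longrightarrow> D i \<noteq> {} \<and> closed (D i) \<and> convex (D i)"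
    and "horizon_cone C \<inter> (\<Inter>i\<in>{1..m}. horizon_cone (D i)) = {0}"
    and "\<psi> \<in> Theta"
    and "KL_function (\<lambda>y. ereal (Psi D m \<psi> y) + indicator_ereal C y)"
    and "0 < \<alpha>min" and "\<alpha>min < \<alpha>max" and "0 < \<eta>" and "\<eta> < 1" and "0 < \<sigma>"
    and "sGP_ls_sequence C D m \<psi> \<alpha>min \<alpha>max \<eta> \<sigma> 0 x"
  shows "\<exists>xb. x \<longlonglongrightarrow> xb \<and> stationary_point C D m \<psi> xb"
proof -
  interpret distance_sum D m \<psi> using assms(4,6) by unfold_locales auto
  let ?F = "Psi D m \<psi>" and ?G = "Psi_grad D m \<psi>"
  let ?f = "\<lambda>y. ereal (Psi D m \<psi> y) + indicator_ereal C y"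

  \<comment> \<open>Lower bound on the step sizes and sufficient descent\<close>
  define \<Lambda> where "\<Lambda> = m * right_deriv \<psi> 0"
  have \<Lambda>: "0 < \<Lambda>" using Theta_right_deriv_0(2)[OF \<psi>] \<open>m \<ge> 1\<close> by (simp add: \<Lambda>_def)
  \<comment> \<open>The threshold at which \<open>1 / (2 * \<beta>)\<close> reaches
    \<open>\<Lambda> + \<sigma> / 2\<close>: the proximal term then pays for the curvature of
    \<open>\<Psi>\<close> and for the required decrease.\<close>
  define A where "A = 1 / (2 * \<Lambda> + \<sigma>)"
  have A: "0 < A" using \<Lambda> \<open>0 < \<sigma>\<close> by (simp add: A_def)
  define c where "c = min \<alpha>min (\<eta> * A)"
  have c: "0 < c" using A \<open>0 < \<alpha>min\<close> \<open>0 < \<eta>\<close> by (simp add: c_def)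
  have step: "\<exists>\<beta>\<ge>c. x (Suc t) \<in> trial_points C (x t) (?G (x t)) \<beta>
      \<and> ?F (x (Suc t)) - ?F (x t) \<le> - (\<sigma> / 2) * (norm (x (Suc t) - x t))\<^sup>2" if xC: "x t \<in> C" for t
  proof -
    obtain \<alpha> \<xi> where \<alpha>: "\<alpha> \<in> {\<alpha>min..\<alpha>max}" and \<xi>: "\<And>i. i \<in> {1..m} \<Longrightarrow> \<xi> i \<in> proj (D i) (x t)"
      and ls: "line_search C ?F \<eta> \<sigma> (Max ((\<lambda>i. ?F (x i)) ` {t - 0..t})) (x t)
          (2 *\<^sub>R (\<Sum>i=1..m. right_deriv \<psi> ((infdist (x t) (D i))\<^sup>2) *\<^sub>R (x t - \<xi> i))) \<alpha> (x (Suc t))"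
      using assms(13) unfolding sGP_ls_sequence_def by blast
    have "\<xi> i = closest_point (D i) (x t)" if "i \<in> {1..m}" for i
      using proj_eq_closest_point[OF _ _ \<xi>[OF that]] D[OF that] by blast
    then have "2 *\<^sub>R (\<Sum>i=1..m. right_deriv \<psi> ((infdist (x t) (D i))\<^sup>2) *\<^sub>R (x t - \<xi> i)) = ?G (x t)"
      unfolding Psi_grad_def scaleR_sum_right by (intro sum.cong) auto
    \<comment> \<open>For \<open>M = 0\<close> the window is the single index \<open>t\<close>, so
      the reference value is the current one.\<close>
    with ls have ls: "line_search C ?F \<eta> \<sigma> (?F (x t)) (x t) (?G (x t)) \<alpha> (x (Suc t))" by simp
    have acc: "?F v - ?F (x t) \<le> - (\<sigma> / 2) * (norm (v - x t))\<^sup>2"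
      if "0 < \<beta>" "\<beta> \<le> A" "v \<in> trial_points C (x t) (?G (x t)) \<beta>" for \<beta> v
    proof -
      \<comment> \<open>The trial point is compared with the feasible point \<open>x t\<close>,
        where the model is 0.\<close>
      have "?G (x t) \<bullet> (v - x t) \<le> - (1 / (2 * \<beta>) * (norm (v - x t))\<^sup>2)"
        using trial_pointsD(2)[OF that(3) xC] by simp
      moreover have "\<Lambda> + \<sigma> / 2 \<le> 1 / (2 * \<beta>)"
        using that \<Lambda> \<open>0 < \<sigma>\<close> by (simp add: A_def field_simps)
      then have "(\<Lambda> + \<sigma> / 2) * (norm (v - x t))\<^sup>2 \<le> 1 / (2 * \<beta>) * (norm (v - x t))\<^sup>2"
        by (rule mult_right_mono) simp
      ultimately show ?thesis
        using Psi_le_quadratic[of v "x t"] unfolding \<Lambda>_def[symmetric] by (simp add: algebra_simps)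
    qed
    have "0 < \<alpha>" using \<alpha> \<open>0 < \<alpha>min\<close> by simp
    from line_search_step_bound[OF ls this \<open>0 < \<eta>\<close>, of A] acc
    obtain \<beta> where "\<beta> \<ge> min \<alpha> (\<eta> * A)" "x (Suc t) \<in> trial_points C (x t) (?G (x t)) \<beta>"
       "?F (x (Suc t)) - ?F (x t) \<le> - (\<sigma> / 2) * (norm (x (Suc t) - x t))\<^sup>2" by blast
    moreover have "c \<le> min \<alpha> (\<eta> * A)" using \<alpha> by (auto simp: c_def)
    ultimately show ?thesis by (intro exI[of _ \<beta>]) auto
  qed
  have xC: "x t \<in> C" for t
  proof (induction t)
    case 0
    then show ?case using assms(13) by (simp add: sGP_ls_sequence_def)
  next
    case (Suc t)
    then show ?case using step[OF Suc] trial_pointsD(1) by blast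
  qed
  have "\<forall>t. \<exists>\<beta>. c \<le> \<beta> \<and> x (Suc t) \<in> trial_points C (x t) (?G (x t)) \<beta>"
    using step[OF xC] by blast
  then obtain \<beta> where \<beta>: "\<And>t. c \<le> \<beta> t" and trial: "\<And>t. x (Suc t) \<in> trial_points C (x t) (?G (x t)) (\<beta> t)"
    by metis
  have descent: "?F (x (Suc t)) + \<sigma> / 2 * (norm (x (Suc t) - x t))\<^sup>2 \<le> ?F (x t)" for t
    using step[OF xC, of t] by auto
  define \<delta> where "\<delta> t = norm (x (Suc t) - x t)" for t
  have dec: "decseq (\<lambda>t. ?F (x t))"
    unfolding decseq_Suc_iff
  proof
    fix t
    have "0 \<le> \<sigma> / 2 * (norm (x (Suc t) - x t))\<^sup>2" using \<open>0 < \<sigma>\<close> by simp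
    with descent[of t] show "?F (x (Suc t)) \<le> ?F (x t)" by linarith
  qed

  \<comment> \<open>Boundedness, cluster point and limiting value\<close>
  have "range x \<subseteq> {y \<in> C. ?F y \<le> ?F (x 0)}"
    using xC decseqD[OF dec, of 0] by auto
  then have bdd: "bounded (range x)"
    using bounded_subset[OF bounded_level_set] assms(5) by blast
  then obtain L where L: "L-lipschitz_on (range x) ?G" using Psi_grad_lipschitz_on_bounded by blast
  obtain xh r where r: "strict_mono r" "(x \<circ> r) \<longlonglongrightarrow> xh"
    using bounded_imp_convergent_subsequence[OF bdd] by blast
  have xhC: "xh \<in> C"
    using closed_sequentially[OF \<open>closed C\<close> _ r(2)] xC by simp
  obtain Fh where Fh: "(\<lambda>t. ?F (x t)) \<longlonglongrightarrow> Fh"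
    using decseq_convergent[OF dec, of 0] Psi_nonneg by blast
  have "(\<lambda>t. ?F ((x \<circ> r) t)) \<longlonglongrightarrow> ?F xh"
    using continuous_on_tendsto_compose[OF continuous_on_Psi r(2)] by simp
  with LIMSEQ_subseq_LIMSEQ[OF Fh r(1)] have "Fh = ?F xh"
    by (simp add: o_def LIMSEQ_unique)
  with Fh have Flim: "(\<lambda>t. ?F (x t)) \<longlonglongrightarrow> ?F xh" by simp
  have \<delta>lim: "\<delta> \<longlonglongrightarrow> 0"
  proof (rule tendsto_sandwich[OF _ _ tendsto_const])
    show "\<forall>\<^sub>F t in sequentially. 0 \<le> \<delta> t" by (simp add: \<delta>_def)
    have "\<delta> t \<le> sqrt (2 / \<sigma> * (?F (x t) - ?F (x (Suc t))))" for t
      by (rule real_le_rsqrt) (use descent[of t] \<open>0 < \<sigma>\<close> in \<open>simp add: \<delta>_def field_simps\<close>)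
    then show "\<forall>\<^sub>F t in sequentially. \<delta> t \<le> sqrt (2 / \<sigma> * (?F (x t) - ?F (x (Suc t))))" by simp
    have "(\<lambda>t. sqrt (2 / \<sigma> * (?F (x t) - ?F (x (Suc t))))) \<longlonglongrightarrow> sqrt (2 / \<sigma> * (?F xh - ?F xh))"
      by (intro tendsto_intros Flim LIMSEQ_Suc[OF Flim])
    then show "(\<lambda>t. sqrt (2 / \<sigma> * (?F (x t) - ?F (x (Suc t))))) \<longlonglongrightarrow> 0" by simp
  qed

  \<comment> \<open>Proximal normals and subgradients from the subproblem\<close>
  define n where "n t = - (?G (x t) + (1 / \<beta> t) *\<^sub>R (x (Suc t) - x t))" for t
  \<comment> \<open>\<open>- n t\<close> is the gradient of the subproblem at its solution and
    contains \<open>?G\<close> at the old iterate. Adding \<open>?G\<close> at the new one leaves a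
    difference of gradients and a scaled step, both of order \<open>\<delta> t\<close>.\<close>
  define w where "w t = ?G (x (Suc t)) + n t" for t
  have opt: "n t \<bullet> (y - x (Suc t)) - 1 / (2 * \<beta> t) * (norm (y - x (Suc t)))\<^sup>2 \<le> 0" if "y \<in> C" for y t
    using trial_points_optimality[OF trial that, of t] unfolding n_def inner_minus_left by linarith
  have step_le: "norm ((1 / \<beta> t) *\<^sub>R (x (Suc t) - x t)) \<le> 1 / c * \<delta> t" for t
  proof -
    have "1 / \<beta> t \<le> 1 / c" using \<beta>[of t] c by (simp add: frac_le)
    moreover have "0 < \<beta> t" using \<beta>[of t] c by simp
    ultimately show ?thesis unfolding \<delta>_def norm_scaleR by (intro mult_right_mono) auto
  qed
  have n_normal: "n t \<in> regular_subdiff (indicator_ereal C) (x (Suc t))" for t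
  proof (rule regular_subdiffI_quadratic)
    show "indicator_ereal C (x (Suc t)) = ereal 0" using xC by (simp add: indicator_ereal_def)
    show "ereal (0 + n t \<bullet> (y - x (Suc t)) - 1 / (2 * \<beta> t) * (norm (y - x (Suc t)))\<^sup>2) \<le> indicator_ereal C y" for y
      using opt[of y t] by (auto simp: indicator_ereal_def)
  qed (rule zero_less_one)
  have w_reg: "w t \<in> regular_subdiff ?f (x (Suc t))" for t
  proof -
    obtain K where K: "\<And>y. dist y (x (Suc t)) < 1 \<Longrightarrow> ?F (x (Suc t)) + ?G (x (Suc t)) \<bullet> (y - x (Suc t))
        - K * (norm (y - x (Suc t)))\<^sup>2 \<le> ?F y"
      using Psi_ge_quadratic by blast
    show ?thesis
    proof (rule regular_subdiffI_quadratic)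
      show "?f (x (Suc t)) = ereal (?F (x (Suc t)))" using xC by (simp add: indicator_ereal_def)
      \<comment> \<open>The curvatures of the lower model of \<open>\<Psi>\<close> and of the
        proximal normal inequality add up.\<close>
      show "ereal (?F (x (Suc t)) + w t \<bullet> (y - x (Suc t)) - (K + 1 / (2 * \<beta> t)) * (norm (y - x (Suc t)))\<^sup>2) \<le> ?f y"
        if "dist y (x (Suc t)) < 1" for y
        using K[OF that] opt[of y t]
        by (cases "y \<in> C") (auto simp: indicator_ereal_def w_def inner_add_left distrib_right)
    qed (rule zero_less_one)
  qed
  have w_sub: "w t \<in> subdiff ?f (x (Suc t))" for t
    using w_reg regular_subdiff_subset_subdiff by blast
  define b where "b = L + 1 / c"
  have b: "0 < b" using lipschitz_on_nonneg[OF L] c by (simp add: b_def add_nonneg_pos)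
  have w_le: "norm (w t) \<le> b * \<delta> t" for t
  proof -
    have "w t = (?G (x (Suc t)) - ?G (x t)) - (1 / \<beta> t) *\<^sub>R (x (Suc t) - x t)" by (simp add: w_def n_def)
    moreover have "norm (?G (x (Suc t)) - ?G (x t)) \<le> L * \<delta> t"
      using lipschitz_onD[OF L, of "x (Suc t)" "x t"] by (simp add: dist_norm \<delta>_def)
    ultimately show ?thesis
      using norm_triangle_ineq4[of "?G (x (Suc t)) - ?G (x t)" "(1 / \<beta> t) *\<^sub>R (x (Suc t) - x t)"] step_le[of t]
      by (simp only: b_def distrib_right)
  qed
  have wlim: "w \<longlonglongrightarrow> 0"
    by (rule Lim_null_comparison[OF _ tendsto_mult_right_zero[OF \<delta>lim, of b]]) (use w_le in simp)
  have fC: "?f y = ereal (?F y)" if "y \<in> C" for y using that by (simp add: indicator_ereal_def)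

  \<comment> \<open>Convergence of the whole sequence\<close>
  have "0 \<in> subdiff ?f xh"
  proof -
    \<comment> \<open>The KL property is granted only where the subdifferential is nonempty, so 0 is
      first exhibited as a limiting subgradient at \<open>xh\<close>. The indices are shifted by one
      because \<open>w t\<close> belongs to \<open>x (Suc t)\<close>.\<close>
    have "(\<lambda>t. x (Suc (r t)) - x (r t)) \<longlonglongrightarrow> 0"
      using LIMSEQ_subseq_LIMSEQ[OF \<delta>lim r(1)] by (simp add: o_def \<delta>_def tendsto_norm_zero_iff)
    from tendsto_add[OF this r(2)] have X: "(\<lambda>t. x (Suc (r t))) \<longlonglongrightarrow> xh" by (simp add: o_def)
    have "(\<lambda>t. ?F (x (Suc (r t)))) \<longlonglongrightarrow> ?F xh"
      using continuous_on_tendsto_compose[OF continuous_on_Psi X] by simp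
    then have "(\<lambda>t. ?f (x (Suc (r t)))) \<longlonglongrightarrow> ?f xh"
      by (simp add: fC xC xhC)
    moreover have "(\<lambda>t. w (r t)) \<longlonglongrightarrow> 0"
      using LIMSEQ_subseq_LIMSEQ[OF wlim r(1)] by (simp add: o_def)
    moreover have "xh \<in> edom ?f" using xhC by (simp add: edom_def indicator_ereal_def)
    ultimately show ?thesis
      unfolding subdiff_def using X w_reg
      by (intro CollectI conjI exI[of _ "\<lambda>t. x (Suc (r t))"] exI[of _ "\<lambda>t. w (r t)"]) auto
  qed
  then have KL: "KL_property_at ?f xh" using assms(7) unfolding KL_function_def by blast
  have lim: "x \<longlonglongrightarrow> xh"
    using KL_descent_sequence_convergent[OF KL fC[OF xC] fC[OF xhC] _ b descent w_sub w_le[unfolded \<delta>_def]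
        \<delta>lim[unfolded \<delta>_def] r Flim] \<open>0 < \<sigma>\<close>
    by simp

  \<comment> \<open>Stationarity of the limit\<close>
  have "- ?G xh \<in> normal_cone C xh"
  proof -
    have "(\<lambda>t. (1 / \<beta> t) *\<^sub>R (x (Suc t) - x t)) \<longlonglongrightarrow> 0"
      by (rule Lim_null_comparison[OF _ tendsto_mult_right_zero[OF \<delta>lim, of "1 / c"]]) (use step_le in simp)
    moreover have "(\<lambda>t. ?G (x t)) \<longlonglongrightarrow> ?G xh"
      using isCont_tendsto_compose[OF continuous_Psi_grad lim] .
    \<comment> \<open>The limit of these regular normals lies in the limiting normal cone by
      definition, since the indicator is 0 along the iterates.\<close>
    ultimately have "n \<longlonglongrightarrow> - (?G xh + 0)"
      unfolding n_def by (intro tendsto_minus tendsto_add)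
    then show ?thesis
      unfolding normal_cone_def subdiff_def using LIMSEQ_Suc[OF lim] n_normal xC xhC
      by (intro CollectI conjI exI[of _ "\<lambda>t. x (Suc t)"] exI[of _ n])
         (auto simp: edom_def indicator_ereal_def)
  qed
  moreover have "?G xh \<in> (\<Sum>i=1..m. (\<lambda>y. (2 * right_deriv \<psi> ((infdist xh (D i))\<^sup>2)) *\<^sub>R (xh - y)) ` proj (D i) xh)"
    unfolding Psi_grad_def set_sum_alt[OF finite_atLeastAtMost]
  proof (intro CollectI exI conjI ballI)
    show "(2 * right_deriv \<psi> ((infdist xh (D i))\<^sup>2)) *\<^sub>R (xh - closest_point (D i) xh)
        \<in> (\<lambda>y. (2 * right_deriv \<psi> ((infdist xh (D i))\<^sup>2)) *\<^sub>R (xh - y)) ` proj (D i) xh"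
      if "i \<in> {1..m}" for i
      using closest_point_in_proj[of "D i" xh] D[OF that] by (intro imageI) simp
  qed (rule refl)
  ultimately have "stationary_point C D m \<psi> xh"
    unfolding stationary_point_def using set_plus_intro[of "?G xh" _ "- ?G xh"] xhC by auto
  with lim show ?thesis by blast
qed

end
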